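(* Let $\mathscr{C}$ be a finite fuzzy covering on $\mathbb{U}$, let $O$ be an overlap function and $I_O$ its $R_O$-implicator. Let $N_3^{\mathscr{C}}$, $N_3^{\mathscr{C}_2}$ and $N_3^{\mathscr{C}_\cap}$ be the fuzzy neighborhood operators defined by $I_O$ from the coverings $\mathscr{C}$, $\mathscr{C}_2$ and $\mathscr{C}_\cap$ respectively. Then (1) $N_3^{\mathscr{C}}=N_3^{\mathscr{C}_2}$; (2) $N_3^{\mathscr{C}}=N_3^{\mathscr{C}_\cap}$.
   Context: $\mathbb{U}$ is a non-empty set; fuzzy subsets of $\mathbb{U}$ are maps $\mathbb{U}\to[0,1]$; inclusion is pointwise $\le$ and intersection is the pointwise infimum. Infima are taken in $[0,1]$. A fuzzy covering on $\mathbb{U}$ is a collection $\mathscr{C}$ of fuzzy subsets of $\mathbb{U}$, none identically $0$, such that for every $x\in\mathbb{U}$ there is $K\in\mathscr{C}$ with $K(x)=1$. For a collection $\mathscr{D}$ of fuzzy sets and $x\in\mathbb{U}$: $\mathbb{C}(\mathscr{D},x)=\{K\in\mathscr{D}:K(x)>0\}$; $MD(\mathscr{D},x)=\{K\in\mathbb{C}(\mathscr{D},x):\forall S\in\mathbb{C}(\mathscr{D},x),\ (S(x)=K(x)\text{ and }S\supseteq K)\Rightarrow S=K\}$. Derived coverings: $\mathscr{C}_2=\bigcup\{MD(\mathscr{C},x):x\in\mathbb{U}\}$; $\mathscr{C}_\cap=\mathscr{C}\setminus\{K\in\mathscr{C}:\exists\text{ non-empty }\mathscr{C}'\subseteq\mathscr{C}\setminus\{K\}\text{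 with }K=\bigcap\mathscr{C}'\}$. An overlap function is a map $O:[0,1]^2\to[0,1]$ that is commutative, increasing (non-decreasing in each argument), continuous, and satisfies $O(x,y)=0\iff xy=0$ and $O(x,y)=1\iff xy=1$. Its $R_O$-implicator is $I_O(x,y)=\max\{z\in[0,1]:O(x,z)\le y\}$. For $x,y\in\mathbb{U}$: $N_3^{\mathscr{D}}(x)(y)=\inf_{K\in MD(\mathscr{D},x)}I_O(K(x),K(y))$. Equality of operators means equality of $N(x)(y)$ for all $x,y\in\mathbb{U}$. *)

theory Defs
  imports "HOL-Analysis.Analysis"
begin

text \<open>
  The universe is the type \<^typ>\<open>'u\<close> (types are non-empty).  A fuzzy set is a real-valued function
  with values in \<open>{0..1}\<close>, so fuzzy inclusion is the pointwise order \<open>\<le>\<close> on functions.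
\<close>

definition fuzzy_set :: "('u \<Rightarrow> real) \<Rightarrow> bool" where
  "fuzzy_set K \<longleftrightarrow> (\<forall>x. K x \<in> {0..1})"

text \<open>
  Infimum in the complete lattice \<open>[0,1]\<close>.  Inserting the top element 1 is harmless for
  non-empty subsets and gives the empty set the infimum 1, whereas the real \<open>Inf {}\<close> is arbitrary.
\<close>

definition unit_Inf :: "real set \<Rightarrow> real" where
  "unit_Inf S = Inf (insert 1 S)"

lemma unit_Inf_empty: "unit_Inf {} = 1"
  by (simp add: unit_Inf_def)

lemma unit_Inf_eq_Inf:
  assumes "S \<noteq> {}" "S \<subseteq> {0..1}"
  shows "unit_Inf S = Inf S"
proof -
  have bdd: "bdd_below S"
    using assms(2) by (meson bdd_below_Icc bdd_below_mono)
  obtain s where s: "s \<in> S" using assms(1) by blast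
  have "Inf S \<le> s" by (rule cInf_lower[OF s bdd])
  moreover have "s \<le> 1" using s assms(2) by auto
  ultimately have "Inf S \<le> 1" by simp
  then show ?thesis
    by (simp add: unit_Inf_def cInf_insert[OF assms(1) bdd] inf_absorb2)
qed

definition fuzzy_Inter :: "('u \<Rightarrow> real) set \<Rightarrow> 'u \<Rightarrow> real" where
  "fuzzy_Inter D = (\<lambda>x. unit_Inf ((\<lambda>K. K x) ` D))"

definition fuzzy_covering :: "('u \<Rightarrow> real) set \<Rightarrow> bool" where
  "fuzzy_covering C \<longleftrightarrow>
     (\<forall>K\<in>C. fuzzy_set K \<and> K \<noteq> (\<lambda>_. 0)) \<and>
     (\<forall>x. \<exists>K\<in>C. K x = 1)"

definition nbh_system :: "('u \<Rightarrow> real) set \<Rightarrow> 'u \<Rightarrow> ('u \<Rightarrow> real) set" where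
  "nbh_system D x = {K \<in> D. K x > 0}"

definition max_descr :: "('u \<Rightarrow> real) set \<Rightarrow> 'u \<Rightarrow> ('u \<Rightarrow> real) set" where
  "max_descr D x =
     {K \<in> nbh_system D x. \<forall>S \<in> nbh_system D x. S x = K x \<and> K \<le> S \<longrightarrow> S = K}"

definition cov_2 :: "('u \<Rightarrow> real) set \<Rightarrow> ('u \<Rightarrow> real) set" where
  "cov_2 C = (\<Union>x. max_descr C x)"

definition cov_Int :: "('u \<Rightarrow> real) set \<Rightarrow> ('u \<Rightarrow> real) set" where
  "cov_Int C = C - {K \<in> C. \<exists>C'. C' \<noteq> {} \<and> C' \<subseteq> C - {K} \<and> K = fuzzy_Inter C'}"

text \<open>
  Functions on \<open>[0,1]\<^sup>2\<close> are total functions on the reals; only their values on the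
  unit square are constrained.
\<close>

definition overlap_function :: "(real \<Rightarrow> real \<Rightarrow> real) \<Rightarrow> bool" where
  "overlap_function f \<longleftrightarrow>
     (\<forall>x\<in>{0..1}. \<forall>y\<in>{0..1}. f x y \<in> {0..1}) \<and>
     (\<forall>x\<in>{0..1}. \<forall>y\<in>{0..1}. f x y = f y x) \<and>
     (\<forall>x\<in>{0..1}. \<forall>x'\<in>{0..1}. \<forall>y\<in>{0..1}. x \<le> x' \<longrightarrow> f x y \<le> f x' y) \<and>
     (\<forall>x\<in>{0..1}. \<forall>y\<in>{0..1}. \<forall>y'\<in>{0..1}. y \<le> y' \<longrightarrow> f x y \<le> f x y') \<and>
     continuous_on ({0..1} \<times> {0..1}) (\<lambda>(x, y). f x y) \<and>
     (\<forall>x\<in>{0..1}. \<forall>y\<in>{0..1}. f x y = 0 \<longleftrightarrow> x * y = 0) \<and>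
     (\<forall>x\<in>{0..1}. \<forall>y\<in>{0..1}. f x y = 1 \<longleftrightarrow> x * y = 1)"

text \<open>
  \<open>Max\<close> is only meaningful on finite sets; \<open>GREATEST\<close> denotes the maximum of the (infinite)
  set.  For an overlap function and arguments in \<open>[0,1]\<close> it is attained: the set contains 0 and
  is closed by continuity.
\<close>

definition R_implicator :: "(real \<Rightarrow> real \<Rightarrow> real) \<Rightarrow> real \<Rightarrow> real \<Rightarrow> real" where
  "R_implicator f x y = (GREATEST z. z \<in> {0..1} \<and> f x z \<le> y)"

definition N3 ::
  "(real \<Rightarrow> real \<Rightarrow> real) \<Rightarrow> ('u \<Rightarrow> real) set \<Rightarrow> 'u \<Rightarrow> 'u \<Rightarrow> real" where
  "N3 I D x y = unit_Inf ((\<lambda>K. I (K x) (K y)) ` max_descr D x)"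

end

(* Both C_2 and C_Int lie between the union of the maximal descriptions of C and C itself.
   By finiteness every member K of C with K x > 0 lies below a maximal one with the same value
   at x, so passing to such an intermediate collection does not change the maximal descriptions.
   Maximal descriptions survive in C_Int because a finite intersection attains its value at x
   at one of its members, which would then be a larger set with that same value. *)
theory Submission
  imports Defs
begin

text \<open>The condition in \<open>max_descr\<close> compares \<open>K\<close> only with sets of
  the same value at \<open>x\<close>, so it is plain maximality inside one level set
  \<open>?A\<close>, which is finite.\<close>

lemma ex_max_descr_above:
  assumes fin: "finite C" and K: "K \<in> nbh_system C x"
  obtains S where "S \<in> max_descr C x" "S x = K x" "K \<le> S"
proof -
  let ?A = "{S \<in> nbh_system C x. S x = K x}"
  have "finite ?A" "K \<in> ?A"
    using fin K by (auto simp: nbh_system_def)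
  then obtain S where "S \<in> ?A" "K \<le> S" "\<forall>T\<in>?A. S \<le> T \<longrightarrow> S = T"
    using finite_has_maximal2[of ?A K] by auto
  then show thesis
    by (intro that) (auto simp: max_descr_def)
qed

lemma max_descr_eqI:
  assumes fin: "finite C" and sub: "max_descr C x \<subseteq> D" "D \<subseteq> C"
  shows "max_descr D x = max_descr C x"
proof (intro equalityI subsetI)
  fix K assume K: "K \<in> max_descr D x"
  then have "K \<in> nbh_system C x"
    using sub(2) by (auto simp: max_descr_def nbh_system_def)
  then obtain S where S: "S \<in> max_descr C x" "S x = K x" "K \<le> S"
    using ex_max_descr_above[OF fin] by blast
  \<comment> \<open>Now \<open>S\<close> competes with \<open>K\<close> inside \<open>D\<close>, so
    maximality of \<open>K\<close> there forces \<open>S = K\<close>.\<close>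
  moreover have "S \<in> nbh_system D x"
    using S(1) sub(1) by (auto simp: max_descr_def nbh_system_def)
  ultimately show "K \<in> max_descr C x"
    using K by (auto simp: max_descr_def)
next
  fix K assume "K \<in> max_descr C x"
  with sub show "K \<in> max_descr D x"
    by (auto simp: max_descr_def nbh_system_def)
qed

text \<open>For values in [0,1], non-emptiness makes the extra 1 in \<open>unit_Inf\<close> harmless
  and finiteness turns the infimum into a minimum; \<open>S\<close> may depend on
  \<open>x\<close>.\<close>

lemma fuzzy_Inter_attained:
  assumes "finite D" "D \<noteq> {}" and "\<And>K. K \<in> D \<Longrightarrow> fuzzy_set K"
  obtains S where "S \<in> D" "S x = fuzzy_Inter D x"
proof -
  let ?V = "(\<lambda>K. K x) ` D"
  have "fuzzy_Inter D x = Min ?V"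
    using assms unfolding fuzzy_Inter_def
    by (subst unit_Inf_eq_Inf) (auto simp: fuzzy_set_def cInf_eq_Min)
  also have "\<dots> \<in> ?V"
    using assms by (intro Min_in) auto
  finally show thesis
    using that by auto
qed

lemma fuzzy_Inter_le:
  assumes "K \<in> D" and "\<And>K. K \<in> D \<Longrightarrow> fuzzy_set K"
  shows "fuzzy_Inter D \<le> K"
proof (rule le_funI)
  fix x
  have "bdd_below ((\<lambda>K. K x) ` D)"
    using assms(2) by (intro bdd_belowI[of _ 0]) (auto simp: fuzzy_set_def)
  then show "fuzzy_Inter D x \<le> K x"
    using assms(1) by (auto simp: fuzzy_Inter_def unit_Inf_def intro!: cInf_lower)
qed

lemma max_descr_subset_cov_Int:
  assumes fin: "finite C" and fuzzy: "\<And>K. K \<in> C \<Longrightarrow> fuzzy_set K"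
  shows "max_descr C x \<subseteq> cov_Int C"
proof
  fix K assume K: "K \<in> max_descr C x"
  have False if C': "C' \<noteq> {}" "C' \<subseteq> C - {K}" "K = fuzzy_Inter C'" for C'
  proof -
    have fuzzy': "\<And>L. L \<in> C' \<Longrightarrow> fuzzy_set L" and "finite C'"
      using fuzzy C'(2) fin by (auto intro: finite_subset)
    then obtain S where S: "S \<in> C'" "S x = K x"
      using fuzzy_Inter_attained[of C' x] C'(1,3) by metis
    moreover have "K \<le> S"
      using fuzzy_Inter_le[OF S(1) fuzzy'] C'(3) by simp
    \<comment> \<open>\<open>S\<close> differs from \<open>K\<close> because \<open>C'\<close> omits
      \<open>K\<close>; as \<open>S x = K x > 0\<close>, it refutes the maximality of
      \<open>K\<close>.\<close>
    moreover have "S \<in> C" "S \<noteq> K"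
      using S(1) C'(2) by auto
    ultimately show False
      using K by (auto simp: max_descr_def nbh_system_def)
  qed
  with K show "K \<in> cov_Int C"
    by (auto simp: cov_Int_def max_descr_def nbh_system_def)
qed

theorem proposition4p3:
  fixes C :: "('u \<Rightarrow> real) set"
    and ov :: "real \<Rightarrow> real \<Rightarrow> real"
  assumes "finite C"
    and "fuzzy_covering C"
    and "overlap_function ov"
  shows "N3 (R_implicator ov) C = N3 (R_implicator ov) (cov_2 C)
       \<and> N3 (R_implicator ov) C = N3 (R_implicator ov) (cov_Int C)"
proof -
  have "max_descr (cov_2 C) x = max_descr C x" for x
    using assms(1)
    by (rule max_descr_eqI) (auto simp: cov_2_def max_descr_def nbh_system_def)
  moreover have "max_descr (cov_Int C) x = max_descr C x" for x
    using assms(1)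
  proof (rule max_descr_eqI)
    show "max_descr C x \<subseteq> cov_Int C"
      using assms(1,2) by (intro max_descr_subset_cov_Int) (auto simp: fuzzy_covering_def)
  qed (auto simp: cov_Int_def)
  \<comment> \<open>\<open>N3\<close> sees the collection only through
    \<open>max_descr\<close>.\<close>
  ultimately show ?thesis
    by (simp add: N3_def fun_eq_iff)
qed

end
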